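(* Assume that almost all $3K_1$-free graphs have $\chi = \omega$ and almost all $2K_2$-free graphs have $\chi=\omega$. Let $\ell \in \{3,4\}$. Then almost every $C_\ell$-free graph $G$ satisfies $c(G) < \alpha(G)$.
   Context: All graphs are finite and simple. For a graph $H$, a graph $G$ is $H$-free if it has no induced subgraph isomorphic to $H$. $3K_1$ is the edgeless graph on $3$ vertices, $2K_2$ is the disjoint union of two edges, and $C_\ell$ is the cycle on $\ell$ vertices. "Almost every graph in a class $\mathcal{G}$ has property $P$" means that the proportion of $n$-vertex graphs in $\mathcal{G}$ having $P$ tends to $1$ as $n\to\infty$. $\chi$, $\omega$, $\alpha$ denote chromatic number, clique number and independence number. The Cops and Robbers game on $G$: first $m$ cops are placed on vertices, then the robber is placed; players alternate turns starting with the cops; on a turn each cop (resp. the robber) moves to an adjacent vertex or stays. The cops win if after finitely many moves a cop occupies the robber's vertex. The cop number $c(G)$ is the least $m$ such that $m$ cops can always win (for a disconnected graph the game is played on the whole graph). *)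

theory Defs
  imports Complex_Main "HOL-Library.Ramsey"
begin

text \<open>Graphs are pairs (vertex set, edge set); an edge is a two-element set of vertices, so
  that \<^const>\<open>clique\<close> and \<^const>\<open>indep\<close> from the library apply.\<close>

type_synonym 'a graph = "'a set \<times> 'a set set"

abbreviation verts :: "'a graph \<Rightarrow> 'a set" where "verts G \<equiv> fst G"
abbreviation edges :: "'a graph \<Rightarrow> 'a set set" where "edges G \<equiv> snd G"

definition simple_graph :: "'a graph \<Rightarrow> bool" where
  "simple_graph G \<longleftrightarrow> finite (verts G) \<and> edges G \<subseteq> [verts G]\<^bsup>2\<^esup>"

definition graph_iso :: "'a graph \<Rightarrow> 'b graph \<Rightarrow> bool" where
  "graph_iso G H \<longleftrightarrow> (\<exists>f. bij_betw f (verts G) (verts H) \<and>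
     (\<forall>u\<in>verts G. \<forall>v\<in>verts G. {u, v} \<in> edges G \<longleftrightarrow> {f u, f v} \<in> edges H))"

definition induced_subgraph :: "'a graph \<Rightarrow> 'a set \<Rightarrow> 'a graph" where
  "induced_subgraph G W = (W, {e \<in> edges G. e \<subseteq> W})"

definition free_of :: "'b graph \<Rightarrow> 'a graph \<Rightarrow> bool" where
  "free_of H G \<longleftrightarrow> \<not> (\<exists>W\<subseteq>verts G. graph_iso H (induced_subgraph G W))"

definition three_K1 :: "nat graph" where
  "three_K1 = ({0, 1, 2}, {})"

definition two_K2 :: "nat graph" where
  "two_K2 = ({0, 1, 2, 3}, {{0, 1}, {2, 3}})"

text \<open>Meaningful for \<open>l \<ge> 3\<close> only.\<close>

definition cycle_graph :: "nat \<Rightarrow> nat graph" where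
  "cycle_graph l = ({..<l}, {{i, Suc i mod l} |i. i < l})"

definition chromatic_number :: "'a graph \<Rightarrow> nat" where
  "chromatic_number G = (LEAST k. \<exists>col. col ` verts G \<subseteq> {..<k} \<and>
     (\<forall>u\<in>verts G. \<forall>v\<in>verts G. {u, v} \<in> edges G \<longrightarrow> col u \<noteq> col v))"

definition clique_number :: "'a graph \<Rightarrow> nat" where
  "clique_number G = Max (card ` {K. K \<subseteq> verts G \<and> clique K (edges G)})"

definition independence_number :: "'a graph \<Rightarrow> nat" where
  "independence_number G = Max (card ` {I. I \<subseteq> verts G \<and> indep I (edges G)})"

definition step :: "'a graph \<Rightarrow> 'a \<Rightarrow> 'a \<Rightarrow> bool" where
  "step G u v \<longleftrightarrow> u \<in> verts G \<and> v \<in> verts G \<and> (u = v \<or> {u, v} \<in> edges G)"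

text \<open>\<open>r 0\<close> is the robber's initial vertex, \<open>r t\<close> its vertex after its \<open>t\<close>-th move.\<close>

definition robber_play :: "'a graph \<Rightarrow> (nat \<Rightarrow> 'a) \<Rightarrow> bool" where
  "robber_play G r \<longleftrightarrow> r 0 \<in> verts G \<and> (\<forall>t. step G (r t) (r (Suc t)))"

text \<open>A strategy of the cops maps the list of all robber positions seen so far to the
  positions of the cops; cop number \<open>i < m\<close> is at \<open>S h i\<close>. Thus \<open>S []\<close> is the initial placement,
  and \<open>cops_at S r t\<close> is the configuration after the \<open>t\<close>-th move of the cops against the
  robber play \<open>r\<close>, chosen knowing \<open>r 0, \<dots>, r (t - 1)\<close>. Cops may share vertices.\<close>

definition cops_at :: "('a list \<Rightarrow> nat \<Rightarrow> 'a) \<Rightarrow> (nat \<Rightarrow> 'a) \<Rightarrow> nat \<Rightarrow> nat \<Rightarrow> 'a" where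
  "cops_at S r t = S (map r [0..<t])"

definition cop_strategy :: "'a graph \<Rightarrow> nat \<Rightarrow> ('a list \<Rightarrow> nat \<Rightarrow> 'a) \<Rightarrow> bool" where
  "cop_strategy G m S \<longleftrightarrow> (\<forall>i<m. S [] i \<in> verts G) \<and>
     (\<forall>r. robber_play G r \<longrightarrow> (\<forall>t. \<forall>i<m. step G (cops_at S r t i) (cops_at S r (Suc t) i)))"

text \<open>The two disjuncts: some cop is on the robber's vertex right after the robber's
  placement or \<open>t\<close>-th move, or right after the subsequent move of the cops. Plays are
  infinite; what happens after the first capture is irrelevant.\<close>

definition captured :: "nat \<Rightarrow> ('a list \<Rightarrow> nat \<Rightarrow> 'a) \<Rightarrow> (nat \<Rightarrow> 'a) \<Rightarrow> bool" where
  "captured m S r \<longleftrightarrow> (\<exists>t. \<exists>i<m. cops_at S r t i = r t \<or> cops_at S r (Suc t) i = r t)"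

definition cops_can_win :: "'a graph \<Rightarrow> nat \<Rightarrow> bool" where
  "cops_can_win G m \<longleftrightarrow>
     (\<exists>S. cop_strategy G m S \<and> (\<forall>r. robber_play G r \<longrightarrow> captured m S r))"

definition cop_number :: "'a graph \<Rightarrow> nat" where
  "cop_number G = (LEAST m. cops_can_win G m)"

text \<open>Counting is over labelled graphs, i.e. graphs with vertex set \<open>{..<n}\<close>.\<close>

definition labelled_graphs :: "nat \<Rightarrow> (nat graph \<Rightarrow> bool) \<Rightarrow> nat graph set" where
  "labelled_graphs n \<G> = {G. simple_graph G \<and> verts G = {..<n} \<and> \<G> G}"

definition almost_every :: "(nat graph \<Rightarrow> bool) \<Rightarrow> (nat graph \<Rightarrow> bool) \<Rightarrow> bool" where
  "almost_every \<G> P \<longleftrightarrow>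
     (\<lambda>n. real (card {G \<in> labelled_graphs n \<G>. P G}) / real (card (labelled_graphs n \<G>)))
       \<longlonglongrightarrow> 1"

end

theory Submission
  imports Defs "HOL-Real_Asymp.Real_Asymp"
begin

text \<open>Complementation turns the hypotheses into: almost every \<open>C\<^sub>\<ell>\<close>-free graph \<open>G\<close> is covered by
  \<open>\<alpha>(G)\<close> cliques. One cop in each clique wins at once. With no cop in one clique \<open>K\<close>, the robber
  has to start in \<open>K\<close> and cannot safely leave it, so it suffices that the cops can either see all
  of \<open>K\<close> or send one of them from a clique \<open>Q\<close> into \<open>K\<close> while the robber cannot escape to \<open>Q\<close>. For
  \<open>\<ell> = 4\<close> this works as soon as some edge joins two of the cliques, for \<open>\<ell> = 3\<close> as soon as some
  vertex has degree at least 3. The exceptional graphs (disjoint unions of cliques, respectively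
  graphs of maximum degree at most 2) number at most \<open>(n + 1)\<^bsup>2n\<^esup>\<close>, whereas split graphs and
  bipartite graphs show that there are at least \<open>2\<close> to the power \<open>\<lfloor>n/2\<rfloor>\<lceil>n/2\<rceil>\<close> \<open>C\<^sub>\<ell>\<close>-free graphs.\<close>

section \<open>Complements and induced subgraphs\<close>

definition compl_graph :: "'a graph \<Rightarrow> 'a graph" where
  "compl_graph G = (verts G, [verts G]\<^bsup>2\<^esup> - edges G)"

lemma verts_compl_graph [simp]: "verts (compl_graph G) = verts G"
  by (simp add: compl_graph_def)

lemma doubleton_in_nsets_2_iff: "{u, v} \<in> [V]\<^bsup>2\<^esup> \<longleftrightarrow> u \<in> V \<and> v \<in> V \<and> u \<noteq> v"
  by (auto simp: nsets_def card_insert_if)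

lemma edge_compl_graph_iff:
  "{u, v} \<in> edges (compl_graph G) \<longleftrightarrow>
     u \<in> verts G \<and> v \<in> verts G \<and> u \<noteq> v \<and> {u, v} \<notin> edges G"
  by (auto simp: compl_graph_def doubleton_in_nsets_2_iff)

lemma simple_graph_compl: "simple_graph G \<Longrightarrow> simple_graph (compl_graph G)"
  by (auto simp: simple_graph_def compl_graph_def)

lemma compl_graph_compl_graph: "simple_graph G \<Longrightarrow> compl_graph (compl_graph G) = G"
  by (cases G) (auto simp: simple_graph_def compl_graph_def)

lemma simple_graph_edgeD:
  assumes "simple_graph G" "{u, v} \<in> edges G"
  shows "u \<in> verts G" "v \<in> verts G" "u \<noteq> v"
proof -
  have "{u, v} \<in> [verts G]\<^bsup>2\<^esup>"
    using assms unfolding simple_graph_def by blast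
  then show "u \<in> verts G" "v \<in> verts G" "u \<noteq> v"
    unfolding doubleton_in_nsets_2_iff by simp_all
qed

lemma simple_graph_edgeE:
  assumes "simple_graph G" "e \<in> edges G"
  obtains u v where "e = {u, v}" "u \<in> verts G" "v \<in> verts G" "u \<noteq> v"
  using assms unfolding simple_graph_def nsets_def by (auto simp: card_2_iff)

text \<open>Embeddings are easier to compose and to complement than vertex sets: \<open>W\<close> is
  recovered as the image of \<open>f\<close>, and the restriction to edges inside \<open>W\<close>
  then holds automatically.\<close>

lemma not_free_of_iff:
  "\<not> free_of H G \<longleftrightarrow> (\<exists>f. inj_on f (verts H) \<and> f ` verts H \<subseteq> verts G \<and>
     (\<forall>u\<in>verts H. \<forall>v\<in>verts H. {u, v} \<in> edges H \<longleftrightarrow> {f u, f v} \<in> edges G))"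
  (is "_ \<longleftrightarrow> (\<exists>f. ?emb f)")
proof
  assume "\<not> free_of H G"
  then obtain W f where W: "W \<subseteq> verts G" and f: "bij_betw f (verts H) W"
    "\<forall>u\<in>verts H. \<forall>v\<in>verts H. {u, v} \<in> edges H \<longleftrightarrow> {f u, f v} \<in> {e \<in> edges G. e \<subseteq> W}"
    unfolding free_of_def graph_iso_def induced_subgraph_def fst_conv snd_conv by blast
  have "?emb f"
    using W f bij_betwE[OF f(1)] by (auto simp: bij_betw_def)
  then show "\<exists>f. ?emb f" by (intro exI[of _ f])
next
  assume "\<exists>f. ?emb f"
  then obtain f where f: "?emb f" by (rule exE)
  then have "graph_iso H (induced_subgraph G (f ` verts H))"
    unfolding graph_iso_def induced_subgraph_def
    by (intro exI[of _ f]) (auto simp: bij_betw_def)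
  with f show "\<not> free_of H G"
    unfolding free_of_def by blast
qed

lemma free_of_compl_compl_if_free_of:
  assumes "simple_graph H" "simple_graph G" "free_of H G"
  shows "free_of (compl_graph H) (compl_graph G)"
proof (rule ccontr)
  assume "\<not> ?thesis"
  then obtain f where f: "inj_on f (verts H)" "f ` verts H \<subseteq> verts G"
    and e: "\<And>u v. u \<in> verts H \<Longrightarrow> v \<in> verts H \<Longrightarrow>
      {u, v} \<in> edges (compl_graph H) \<longleftrightarrow> {f u, f v} \<in> edges (compl_graph G)"
    unfolding not_free_of_iff by auto
  have "{u, v} \<in> edges H \<longleftrightarrow> {f u, f v} \<in> edges G" if "u \<in> verts H" "v \<in> verts H" for u v
  \<comment> \<open>For \<open>u = v\<close> the complements say nothing, but both sides are false
    since simple graphs have no loops. For \<open>u \<noteq> v\<close>, injectivity of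
    \<open>f\<close> allows both sides to be negated.\<close>
  proof (cases "u = v")
    case True
    then show ?thesis
      using simple_graph_edgeD(3)[OF assms(1)] simple_graph_edgeD(3)[OF assms(2)] by blast
  next
    case False
    then show ?thesis
      using e[OF that] that f inj_onD[OF f(1), of u v]
      by (auto simp: edge_compl_graph_iff image_subset_iff)
  qed
  with f have "\<not> free_of H G"
    unfolding not_free_of_iff by blast
  with assms(3) show False by simp
qed

lemma free_of_compl_compl:
  assumes "simple_graph H" "simple_graph G"
  shows "free_of (compl_graph H) (compl_graph G) \<longleftrightarrow> free_of H G"
  using free_of_compl_compl_if_free_of[OF assms]
    free_of_compl_compl_if_free_of[OF simple_graph_compl simple_graph_compl, OF assms]
  by (auto simp: compl_graph_compl_graph assms)

lemma free_of_if_graph_iso: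
  assumes "graph_iso H H'" "free_of H G"
  shows "free_of H' G"
proof (rule ccontr)
  assume "\<not> free_of H' G"
  then obtain f where f: "inj_on f (verts H')" "f ` verts H' \<subseteq> verts G"
    "\<And>u v. u \<in> verts H' \<Longrightarrow> v \<in> verts H' \<Longrightarrow> {u, v} \<in> edges H' \<longleftrightarrow> {f u, f v} \<in> edges G"
    unfolding not_free_of_iff by auto
  from assms(1) obtain h where h: "bij_betw h (verts H) (verts H')"
    "\<And>u v. u \<in> verts H \<Longrightarrow> v \<in> verts H \<Longrightarrow> {u, v} \<in> edges H \<longleftrightarrow> {h u, h v} \<in> edges H'"
    unfolding graph_iso_def by auto
  have "inj_on (f \<circ> h) (verts H)" "(f \<circ> h) ` verts H \<subseteq> verts G"
    using f h by (auto simp: bij_betw_def image_subset_iff intro: comp_inj_on)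
  moreover have "{u, v} \<in> edges H \<longleftrightarrow> {(f \<circ> h) u, (f \<circ> h) v} \<in> edges G"
    if "u \<in> verts H" "v \<in> verts H" for u v
    using f(3)[of "h u" "h v"] h(2)[OF that] bij_betwE[OF h(1)] that by auto
  ultimately have "\<not> free_of H G"
    unfolding not_free_of_iff by blast
  with assms(2) show False by simp
qed

section \<open>The cycles of length 3 and 4 as complements and as forbidden subgraphs\<close>

lemma edges_cycle_graph_3: "edges (cycle_graph 3) = {{0, 1}, {1, 2}, {2, 0}}"
proof -
  have "edges (cycle_graph 3) = (\<lambda>i. {i, Suc i mod 3}) ` {..<3}"
    by (auto simp: cycle_graph_def)
  also have "{..<3} = {0, 1, 2::nat}"
    by auto
  finally show ?thesis
    by (simp flip: numeral_2_eq_2)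
qed

lemma edges_cycle_graph_4: "edges (cycle_graph 4) = {{0, 1}, {1, 2}, {2, 3}, {3, 0}}"
proof -
  have "edges (cycle_graph 4) = (\<lambda>i. {i, Suc i mod 4}) ` {..<4}"
    by (auto simp: cycle_graph_def)
  also have "{..<4} = {0, 1, 2, 3::nat}"
    by auto
  finally show ?thesis
    by (simp flip: numeral_2_eq_2)
qed

lemma verts_cycle_graph_3: "verts (cycle_graph 3) = {0, 1, 2}"
  by (auto simp: cycle_graph_def)

lemma verts_cycle_graph_4: "verts (cycle_graph 4) = {0, 1, 2, 3}"
  by (auto simp: cycle_graph_def)

lemma simple_graph_three_K1: "simple_graph three_K1"
  by (simp add: simple_graph_def three_K1_def)

lemma simple_graph_two_K2: "simple_graph two_K2"
  by (simp add: simple_graph_def two_K2_def doubleton_in_nsets_2_iff)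

lemma graph_iso_compl_three_K1: "graph_iso (compl_graph three_K1) (cycle_graph 3)"
  unfolding graph_iso_def
  by (intro exI[of _ id])
    (simp add: edge_compl_graph_iff three_K1_def verts_cycle_graph_3 edges_cycle_graph_3
      doubleton_eq_iff)

lemma graph_iso_compl_two_K2: "graph_iso (compl_graph two_K2) (cycle_graph 4)"
proof -
  \<comment> \<open>The complement of \<open>two_K2\<close> is the cycle 0, 2, 1, 3; exchanging 1
    and 2 puts it in the standard order.\<close>
  define f :: "nat \<Rightarrow> nat" where "f i = (if i = 1 then 2 else if i = 2 then 1 else i)" for i
  have "bij_betw f {0, 1, 2, 3} {0, 1, 2, 3}"
    by (simp add: f_def bij_betw_def inj_on_def insert_commute)
  moreover have "\<forall>u\<in>{0, 1, 2, 3}. \<forall>v\<in>{0, 1, 2, 3}.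
      {u, v} \<in> edges (compl_graph two_K2) \<longleftrightarrow> {f u, f v} \<in> edges (cycle_graph 4)"
    by (simp add: f_def edge_compl_graph_iff edges_cycle_graph_4 two_K2_def doubleton_eq_iff)
  ultimately show ?thesis
    unfolding graph_iso_def by (intro exI[of _ f]) (simp add: two_K2_def verts_cycle_graph_4)
qed

lemma graph_iso_sym:
  assumes "graph_iso H H'"
  shows "graph_iso H' H"
proof -
  from assms obtain f where f: "bij_betw f (verts H) (verts H')"
    "\<And>u v. u \<in> verts H \<Longrightarrow> v \<in> verts H \<Longrightarrow> {u, v} \<in> edges H \<longleftrightarrow> {f u, f v} \<in> edges H'"
    unfolding graph_iso_def by auto
  define g where "g = inv_into (verts H) f"
  have g: "bij_betw g (verts H') (verts H)"
    unfolding g_def using f(1) by (rule bij_betw_inv_into)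
  moreover have "f (g u) = u" if "u \<in> verts H'" for u
    unfolding g_def using f(1) that by (rule bij_betw_inv_into_right)
  ultimately show ?thesis
    unfolding graph_iso_def using f(2) bij_betwE[OF g] by (intro exI[of _ g]) simp
qed

lemma free_of_compl_graph_iff:
  assumes "simple_graph H" "graph_iso (compl_graph H) H'" "simple_graph G"
  shows "free_of H (compl_graph G) \<longleftrightarrow> free_of H' G"
proof -
  have "free_of H (compl_graph G) \<longleftrightarrow> free_of (compl_graph H) G"
    using free_of_compl_compl[OF assms(1) simple_graph_compl[OF assms(3)]]
    by (simp add: compl_graph_compl_graph assms)
  also have "\<dots> \<longleftrightarrow> free_of H' G"
    using free_of_if_graph_iso[OF assms(2)] free_of_if_graph_iso[OF graph_iso_sym[OF assms(2)]]
    by blast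
  finally show ?thesis .
qed

lemma free_of_cycle_graph_3_iff:
  assumes "simple_graph G"
  shows "free_of (cycle_graph 3) G \<longleftrightarrow>
    \<not> (\<exists>a b c. {a, b} \<in> edges G \<and> {b, c} \<in> edges G \<and> {c, a} \<in> edges G)"
proof -
  have "\<not> free_of (cycle_graph 3) G" if "{a, b} \<in> edges G" "{b, c} \<in> edges G" "{c, a} \<in> edges G"
    for a b c
  proof -
    have "{x} \<notin> edges G" for x
      using simple_graph_edgeD(3)[OF assms, of x x] by auto
    moreover have "{b, a} \<in> edges G" "{c, b} \<in> edges G" "{a, c} \<in> edges G"
      using that by (metis insert_commute)+
    moreover note that that[THEN simple_graph_edgeD(1)[OF assms]]
      that[THEN simple_graph_edgeD(3)[OF assms]]
    ultimately show ?thesis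
      unfolding not_free_of_iff verts_cycle_graph_3 edges_cycle_graph_3
      by (intro exI[of _ "\<lambda>i. if i = 0 then a else if i = 1 then b else c"])
        (simp add: doubleton_eq_iff)
  qed
  moreover have "\<exists>a b c. {a, b} \<in> edges G \<and> {b, c} \<in> edges G \<and> {c, a} \<in> edges G"
    if "\<not> free_of (cycle_graph 3) G"
  proof -
    from that obtain f where "\<forall>u\<in>verts (cycle_graph 3). \<forall>v\<in>verts (cycle_graph 3).
        {u, v} \<in> edges (cycle_graph 3) \<longleftrightarrow> {f u, f v} \<in> edges G"
      unfolding not_free_of_iff by blast
    then have "{f 0, f 1} \<in> edges G" "{f 1, f 2} \<in> edges G" "{f 2, f 0} \<in> edges G"
      unfolding verts_cycle_graph_3 edges_cycle_graph_3 by simp_all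
    then show ?thesis by blast
  qed
  ultimately show ?thesis by blast
qed

text \<open>Consecutive vertices are distinct by simplicity, as in a triangle. Opposite vertices
  could coincide in a closed walk of length 4, hence the two inequalities.\<close>

lemma free_of_cycle_graph_4_iff:
  assumes "simple_graph G"
  shows "free_of (cycle_graph 4) G \<longleftrightarrow>
    \<not> (\<exists>a b c d. a \<noteq> c \<and> b \<noteq> d \<and> {a, b} \<in> edges G \<and> {b, c} \<in> edges G \<and> {c, d} \<in> edges G \<and>
         {d, a} \<in> edges G \<and> {a, c} \<notin> edges G \<and> {b, d} \<notin> edges G)"
proof -
  have "\<not> free_of (cycle_graph 4) G"
    if "a \<noteq> c" "b \<noteq> d" and e: "{a, b} \<in> edges G" "{b, c} \<in> edges G" "{c, d} \<in> edges G"
      "{d, a} \<in> edges G" and "{a, c} \<notin> edges G" "{b, d} \<notin> edges G"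
    for a b c d
  proof -
    have "{x} \<notin> edges G" for x
      using simple_graph_edgeD(3)[OF assms, of x x] by auto
    moreover have "{b, a} \<in> edges G" "{c, b} \<in> edges G" "{d, c} \<in> edges G" "{a, d} \<in> edges G"
      "{c, a} \<notin> edges G" "{d, b} \<notin> edges G"
      using that by (metis insert_commute)+
    moreover note that e[THEN simple_graph_edgeD(1)[OF assms]]
      e[THEN simple_graph_edgeD(3)[OF assms]]
    ultimately show ?thesis
      unfolding not_free_of_iff verts_cycle_graph_4 edges_cycle_graph_4
      by (intro exI[of _ "\<lambda>i. if i = 0 then a else if i = 1 then b else if i = 2 then c else d"])
        (simp add: doubleton_eq_iff)
  qed
  moreover have "\<exists>a b c d. a \<noteq> c \<and> b \<noteq> d \<and> {a, b} \<in> edges G \<and> {b, c} \<in> edges G \<and> {c, d} \<in> edges G \<and>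
         {d, a} \<in> edges G \<and> {a, c} \<notin> edges G \<and> {b, d} \<notin> edges G"
    if "\<not> free_of (cycle_graph 4) G"
  proof -
    from that obtain f where f: "inj_on f (verts (cycle_graph 4))"
      "\<forall>u\<in>verts (cycle_graph 4). \<forall>v\<in>verts (cycle_graph 4).
         {u, v} \<in> edges (cycle_graph 4) \<longleftrightarrow> {f u, f v} \<in> edges G"
      unfolding not_free_of_iff by blast
    from f(2) have "{f 0, f 1} \<in> edges G" "{f 1, f 2} \<in> edges G" "{f 2, f 3} \<in> edges G"
      "{f 3, f 0} \<in> edges G" "{f 0, f 2} \<notin> edges G" "{f 1, f 3} \<notin> edges G"
      unfolding verts_cycle_graph_4 edges_cycle_graph_4 by (simp_all add: doubleton_eq_iff)
    moreover from f(1) have "f 0 \<noteq> f 2" "f 1 \<noteq> f 3"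
      unfolding verts_cycle_graph_4 by (simp_all add: inj_on_def)
    ultimately show ?thesis by blast
  qed
  ultimately show ?thesis by blast
qed

lemma clique_number_compl_graph: "clique_number (compl_graph G) = independence_number G"
proof -
  have "clique I (edges (compl_graph G)) \<longleftrightarrow> indep I (edges G)" if "I \<subseteq> verts G" for I
    using that by (auto simp: clique_def indep_def edge_compl_graph_iff)
  then show ?thesis
    unfolding clique_number_def independence_number_def
    by (intro arg_cong[of _ _ "\<lambda>A. Max (card ` A)"]) auto
qed

lemma independence_number_le:
  assumes "finite (verts G)"
  shows "independence_number G \<le> card (verts G)"
proof -
  have "{} \<in> {I. I \<subseteq> verts G \<and> indep I (edges G)}"
    by (simp add: indep_def)
  then show ?thesis
    unfolding independence_number_def using assms
    by (subst Max_le_iff) (auto intro: card_mono)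
qed

section \<open>A strategy for the cops\<close>

text \<open>The cops start at \<open>p\<close>. If the robber is not next to a cop, then cop \<open>q\<close> moves to \<open>s\<close>
  and all other cops stay; now every move of the robber ends next to a cop.\<close>

lemma cops_can_win_two_moves:
  fixes G :: "'a graph" and p :: "'i \<Rightarrow> 'a"
  assumes "finite I" "card I = m"
    and p: "\<And>i. i \<in> I \<Longrightarrow> p i \<in> verts G"
    and q: "q \<in> I" "step G (p q) s"
    and win: "\<And>x y. x \<in> verts G \<Longrightarrow> (\<And>i. i \<in> I \<Longrightarrow> \<not> step G (p i) x) \<Longrightarrow> step G x y \<Longrightarrow>
      step G s y \<or> (\<exists>i\<in>I - {q}. step G (p i) y)"
  shows "cops_can_win G m"
proof -
  obtain h where h: "bij_betw h {..<m} I"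
    using ex_bij_betw_nat_finite[OF assms(1)] assms(2) by (auto simp: atLeast0LessThan)
  have hI: "h i \<in> I" if "i < m" for i
    using bij_betwE[OF h] that by auto
  have ex_h: "\<exists>i<m. h i = j" if "j \<in> I" for j
    using h that by (auto simp: bij_betw_def)
  \<comment> \<open>\<open>first x j\<close> is the place of cop \<open>j\<close> after the first
    move against a robber placed at \<open>x\<close>: capture if possible, otherwise only cop
    \<open>q\<close> moves.\<close>
  define first where "first x j = (if step G (p j) x then x
    else if j = q \<and> (\<forall>i\<in>I. \<not> step G (p i) x) then s else p j)" for x j
  \<comment> \<open>Only the first two robber positions matter. The second move captures
    \<open>y\<close> where possible, and from then on the configuration is constant. Cop number
    \<open>i\<close> plays the role of index \<open>h i\<close>.\<close>
  define S where "S xs i = (case xs of [] \<Rightarrow> p (h i)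
    | x # ys \<Rightarrow> (case ys of [] \<Rightarrow> first x (h i)
       | y # zs \<Rightarrow> (if step G (first x (h i)) y then y else first x (h i))))" for xs i
  have hist: "map r [0..<Suc (Suc t)] = r 0 # r 1 # map r [2..<Suc (Suc t)]"
    for r :: "nat \<Rightarrow> 'a" and t
    by (simp add: upt_conv_Cons numeral_2_eq_2 del: upt_Suc)
  have at0: "cops_at S r 0 i = p (h i)" for r i
    by (simp add: cops_at_def S_def)
  have at1: "cops_at S r (Suc 0) i = first (r 0) (h i)" for r i
    by (simp add: cops_at_def S_def)
  have at2: "cops_at S r (Suc (Suc t)) i =
      (if step G (first (r 0) (h i)) (r 1) then r 1 else first (r 0) (h i))" for r t i
    unfolding cops_at_def hist S_def by simp
  have p_first: "step G (p j) (first x j)" if "j \<in> I" for x j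
    using p[OF that] q by (auto simp: first_def step_def)
  have "step G (cops_at S r t i) (cops_at S r (Suc t) i)" if "i < m" for r t i
  proof -
    have "first (r 0) (h i) \<in> verts G"
      using p_first[OF hI[OF that]] by (auto simp: step_def)
    then show ?thesis
      using p_first[OF hI[OF that]]
      by (cases t; cases "t - 1") (auto simp: at0 at1 at2 step_def)
  qed
  then have "cop_strategy G m S"
    using p hI by (auto simp: cop_strategy_def S_def)
  moreover have "captured m S r" if r: "robber_play G r" for r
  proof (cases "\<exists>j\<in>I. step G (p j) (r 0)")
    case True
    then obtain i where "i < m" "step G (p (h i)) (r 0)"
      using ex_h by blast
    then have "cops_at S r (Suc 0) i = r 0"
      by (simp add: at1 first_def)
    with \<open>i < m\<close> show ?thesis
      unfolding captured_def by blast
  next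
    case False
    from r have "r 0 \<in> verts G" "step G (r 0) (r 1)"
      by (simp_all add: robber_play_def)
    \<comment> \<open>No cop was next to \<open>r 0\<close>, so cop \<open>q\<close> now stands at
      \<open>s\<close> and every other cop is still at its start.\<close>
    with False win consider "step G s (r 1)" | j where "j \<in> I" "j \<noteq> q" "step G (p j) (r 1)"
      by blast
    then obtain j where "j \<in> I" "step G (first (r 0) j) (r 1)"
      using False q(1) by cases (auto simp: first_def)
    then obtain i where "i < m" "step G (first (r 0) (h i)) (r 1)"
      using ex_h by blast
    then have "cops_at S r (Suc 1) i = r 1"
      by (simp add: at2)
    with \<open>i < m\<close> show ?thesis
      unfolding captured_def by blast
  qed
  ultimately show ?thesis
    unfolding cops_can_win_def by blast
qed

section \<open>Cop number of graphs covered by cliques\<close>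

text \<open>A proper \<open>k\<close>-colouring of the complement, read in \<open>G\<close>: the
  colour classes are cliques, some possibly empty. Using \<open>step\<close> in
  \<open>col_eq\<close> includes the case \<open>u = v\<close>.\<close>

locale clique_cover =
  fixes G :: "'a graph" and k :: nat and col :: "'a \<Rightarrow> nat"
  assumes simple: "simple_graph G"
    and col_less: "v \<in> verts G \<Longrightarrow> col v < k"
    and col_eq: "u \<in> verts G \<Longrightarrow> v \<in> verts G \<Longrightarrow> col u = col v \<Longrightarrow> step G u v"
begin

lemma adjacent_if_col_eq:
  "u \<in> verts G \<Longrightarrow> v \<in> verts G \<Longrightarrow> col u = col v \<Longrightarrow> u \<noteq> v \<Longrightarrow> {u, v} \<in> edges G"
  using col_eq[of u v] by (simp add: step_def)

text \<open>Two of the cops, in the cliques of \<open>x\<close> and \<open>y\<close>, have prescribed starting vertices; the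
  clique of \<open>s\<close> gets no cop.\<close>

lemma cop_number_less:
  assumes xs: "{x, s} \<in> edges G" and y: "y \<in> verts G" and col: "col x \<noteq> col s" "col y \<noteq> col s"
    and xy: "col x = col y \<Longrightarrow> x = y"
    and win: "\<And>u v. col u = col s \<Longrightarrow> \<not> step G x u \<Longrightarrow> \<not> step G y u \<Longrightarrow> {u, v} \<in> edges G \<Longrightarrow>
      col v \<noteq> col x"
  shows "cop_number G < k"
proof -
  note xs' = simple_graph_edgeD[OF simple xs]
  \<comment> \<open>Any vertex of a nonempty clique sees the whole clique; for an empty class the
    condition is vacuous and \<open>x\<close> serves.\<close>
  have "\<exists>v\<in>verts G. \<forall>w\<in>verts G. col w = i \<longrightarrow> step G v w" for i
    using col_eq xs'(1) by metis
  then obtain p0 where p0: "\<And>i. p0 i \<in> verts G"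
    "\<And>i w. w \<in> verts G \<Longrightarrow> col w = i \<Longrightarrow> step G (p0 i) w"
    by metis
  define p where "p = p0(col y := y, col x := x)"
  have p: "p i \<in> verts G" for i
    using p0 xs' y by (simp add: p_def)
  have p_col: "step G (p (col w)) w" if "w \<in> verts G" for w
    using p0 xs' y that col_eq by (simp add: p_def)
  have px: "p (col x) = x" "p (col y) = y"
    using xy by (auto simp: p_def)
  let ?I = "{..<k} - {col s}"
  have xI: "col x \<in> ?I" "col y \<in> ?I"
    using col xs' y col_less by auto
  have "cops_can_win G (k - 1)"
  proof (rule cops_can_win_two_moves[of ?I _ p G "col x" s])
    show "card ?I = k - 1"
      using col_less[OF xs'(2)] by simp
    show "step G (p (col x)) s"
      using px xs xs' by (simp add: step_def)
    fix u v
    assume u: "u \<in> verts G" and far: "\<And>i. i \<in> ?I \<Longrightarrow> \<not> step G (p i) u" and uv: "step G u v"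
    have v: "v \<in> verts G"
      using uv by (simp add: step_def)
    \<comment> \<open>Every other clique is seen by its own cop, so an uncaught robber must have
      started in the clique of \<open>s\<close>.\<close>
    have cu: "col u = col s"
      using far[of "col u"] p_col[OF u] col_less[OF u] by auto
    show "step G s v \<or> (\<exists>i\<in>?I - {col x}. step G (p i) v)"
    \<comment> \<open>If the robber remains in the clique of \<open>s\<close>, the cop now at
      \<open>s\<close> sees it. If it leaves, \<open>win\<close> keeps it out of the clique just
      vacated, so it enters one that still has its cop.\<close>
    proof (cases "col v = col s")
      case True
      then show ?thesis
        using col_eq[OF xs'(2) v] by simp
    next
      case False
      then have "{u, v} \<in> edges G"
        using uv cu by (auto simp: step_def)
      then have "col v \<noteq> col x"
        using win[of u v] cu far[OF xI(1)] far[OF xI(2)] px by simp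
      with False show ?thesis
        using p_col[OF v] col_less[OF v] by auto
    qed
  qed (use p xI in auto)
  then have "cop_number G \<le> k - 1"
    unfolding cop_number_def by (rule Least_le)
  with col_less[OF xs'(1)] show ?thesis by linarith
qed

text \<open>Between two cliques of a graph without induced \<open>C\<^sub>4\<close> the neighbourhoods are nested, so a
  vertex of \<open>Q\<close> with the most neighbours in \<open>K\<close> sees every vertex of \<open>K\<close> that has any
  neighbour in \<open>Q\<close>.\<close>

lemma cop_number_less_if_C4_free:
  assumes free: "free_of (cycle_graph 4) G"
    and e: "{a, b} \<in> edges G" "col a \<noteq> col b"
  shows "cop_number G < k"
proof -
  note ab = simple_graph_edgeD[OF simple e(1)]
  \<comment> \<open>\<open>N x\<close> is the neighbourhood of \<open>x\<close> inside the clique K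
    of \<open>b\<close>; \<open>?Q\<close> is the clique of \<open>a\<close>.\<close>
  define N where "N x = {u \<in> verts G. col u = col b \<and> {x, u} \<in> edges G}" for x
  let ?Q = "{x \<in> verts G. col x = col a}"
  have fin: "finite (verts G)"
    using simple by (simp add: simple_graph_def)
  then have finN: "finite (N x)" for x
    by (simp add: N_def)
  have Q: "finite ?Q" "a \<in> ?Q"
    using fin ab by auto
  define M where "M = Max ((\<lambda>z. card (N z)) ` ?Q)"
  have "M \<in> (\<lambda>z. card (N z)) ` ?Q"
    unfolding M_def by (rule Max_in) (use Q in auto)
  moreover have "card (N z) \<le> M" if "z \<in> ?Q" for z
    unfolding M_def by (rule Max_ge) (use Q that in auto)
  ultimately obtain x where x: "x \<in> ?Q" and max: "\<And>z. z \<in> ?Q \<Longrightarrow> card (N z) \<le> card (N x)"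
    by auto
  have "b \<in> N a"
    using ab e by (simp add: N_def)
  then have "card (N x) \<noteq> 0"
    using max[OF Q(2)] finN by (metis card_0_eq empty_iff le_zero_eq)
  then obtain s where s: "s \<in> N x"
    by fastforce
  then have sx: "s \<in> verts G" "col s = col b" "{x, s} \<in> edges G"
    by (auto simp: N_def)
  show ?thesis
  proof (rule cop_number_less[of x s x])
    fix u v
    assume u: "col u = col s" "\<not> step G x u" and uv: "{u, v} \<in> edges G"
    note uv' = simple_graph_edgeD[OF simple uv]
    show "col v \<noteq> col x"
    proof
      assume v: "col v = col x"
      \<comment> \<open>By maximality of \<open>card (N x)\<close>, the extra element
        \<open>u\<close> of \<open>N v\<close> forces some \<open>w\<close> in \<open>N x\<close>
        outside \<open>N v\<close>. Then \<open>v\<close>, \<open>x\<close>, \<open>w\<close>,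
        \<open>u\<close> is an induced four-cycle: \<open>v\<close>, \<open>x\<close> lie in Q and
        \<open>w\<close>, \<open>u\<close> in K, while both diagonals are missing.\<close>
      have "u \<in> N v" "u \<notin> N x"
        using uv uv' u sx x by (auto simp: N_def step_def insert_commute)
      moreover have "card (N v) \<le> card (N x)"
        using max[of v] v x uv' by simp
      ultimately have "\<not> N x \<subseteq> N v"
        using card_seteq[OF finN, of "N x" v] by blast
      then obtain w where w: "w \<in> N x" "w \<notin> N v"
        by blast
      have "v \<noteq> x" "w \<noteq> u"
        using w \<open>u \<notin> N x\<close> by auto
      have "{v, x} \<in> edges G" "{w, u} \<in> edges G" "{x, w} \<in> edges G" "{v, w} \<notin> edges G"
        "{u, x} \<notin> edges G"
        using adjacent_if_col_eq[OF _ _ v \<open>v \<noteq> x\<close>] adjacent_if_col_eq[of w u] \<open>w \<noteq> u\<close>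
          w u uv' x sx by (auto simp: N_def step_def insert_commute)
      moreover have "u \<noteq> x"
        using \<open>u \<notin> N x\<close> u x e sx by auto
      moreover have "v \<noteq> w"
        using v x w e by (auto simp: N_def)
      ultimately show False
        using free uv unfolding free_of_cycle_graph_4_iff[OF simple] by blast
    qed
  qed (use sx x e in auto)
qed

text \<open>Without triangles the clique K of \<open>a\<close> has at most two vertices, so two
  neighbours \<open>x\<close>, \<open>y\<close> of \<open>a\<close> lie outside K, and in different
  cliques. If no other vertex of K has a neighbour in the clique of \<open>x\<close>, the cop at
  \<open>x\<close> can move to \<open>a\<close>: the robber, not being at \<open>a\<close>, cannot
  slip into the vacated clique. Otherwise K is \<open>{a, b}\<close> and \<open>b\<close> has a
  neighbour \<open>d\<close> in the clique of \<open>x\<close>; cops at \<open>d\<close> and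
  \<open>y\<close> then see all of K.\<close>

lemma cop_number_less_if_C3_free:
  assumes free: "free_of (cycle_graph 3) G"
    and e: "{a, b1} \<in> edges G" "{a, b2} \<in> edges G" "{a, b3} \<in> edges G"
    and distinct: "b1 \<noteq> b2" "b2 \<noteq> b3" "b1 \<noteq> b3"
  shows "cop_number G < k"
proof -
  have tri: "\<not> ({x, y} \<in> edges G \<and> {y, z} \<in> edges G \<and> {x, z} \<in> edges G)" for x y z
  proof -
    have "\<not> ({x, y} \<in> edges G \<and> {y, z} \<in> edges G \<and> {z, x} \<in> edges G)"
      using free unfolding free_of_cycle_graph_3_iff[OF simple] by blast
    moreover have "{z, x} = {x, z}"
      by (rule insert_commute)
    ultimately show ?thesis
      by (simp only: not_False_eq_True)
  qed
  have ex: "\<exists>x y. {a, x} \<in> edges G \<and> {a, y} \<in> edges G \<and> x \<noteq> y \<and> col x \<noteq> col a \<and> col y \<noteq> col a"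
  proof -
    have "\<not> (col b = col a \<and> col b' = col a)" if "{a, b} \<in> edges G" "{a, b'} \<in> edges G" "b \<noteq> b'"
      for b b'
      using that tri[of a b b'] adjacent_if_col_eq[of b b'] simple_graph_edgeD[OF simple that(1)]
        simple_graph_edgeD[OF simple that(2)] by auto
    note not_both = this[OF e(1,2) distinct(1)] this[OF e(1,3) distinct(3)]
      this[OF e(2,3) distinct(2)]
    consider "col b1 = col a" | "col b2 = col a" | "col b1 \<noteq> col a" "col b2 \<noteq> col a"
      by blast
    then show ?thesis
      by cases (use not_both e distinct in blast)+
  qed
  then obtain x y where x: "{a, x} \<in> edges G" "col x \<noteq> col a"
    and y: "{a, y} \<in> edges G" "col y \<noteq> col a" and "x \<noteq> y"
    by blast
  note x' = simple_graph_edgeD[OF simple x(1)]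
  note y' = simple_graph_edgeD[OF simple y(1)]
  have "col x \<noteq> col y"
    using adjacent_if_col_eq[OF x'(2) y'(2) _ \<open>x \<noteq> y\<close>] tri[of a x y] x y by blast
  show ?thesis
  proof (cases "\<exists>b d. col b = col a \<and> b \<noteq> a \<and> {b, d} \<in> edges G \<and> col d = col x")
    case False
    have "{x, a} \<in> edges G"
      using x(1) by (simp add: insert_commute)
    then show ?thesis
    proof (rule cop_number_less[OF _ x'(2) x(2) x(2) refl])
      fix u v
      assume u: "col u = col a" "\<not> step G x u" and uv: "{u, v} \<in> edges G"
      have "step G x a"
        using x x' by (simp add: step_def insert_commute)
      then have "u \<noteq> a"
        using u by blast
      then show "col v \<noteq> col x"
        using False u uv by blast
    qed
  next
    case True
    then obtain b d where b: "col b = col a" "b \<noteq> a" and bd: "{b, d} \<in> edges G" "col d = col x"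
      by blast
    note bd' = simple_graph_edgeD[OF simple bd(1)]
    have K: "u = a \<or> u = b" if "col u = col a" "u \<in> verts G" for u
      using tri[of a b u] adjacent_if_col_eq[of a b] adjacent_if_col_eq[of a u]
        adjacent_if_col_eq[of b u] that b bd' x' by auto
    have "{d, b} \<in> edges G" "col d \<noteq> col b" "col y \<noteq> col b" "col d = col y \<Longrightarrow> d = y"
      using bd b x(2) y(2) \<open>col x \<noteq> col y\<close> by (simp_all add: insert_commute)
    then show ?thesis
    \<comment> \<open>Condition \<open>win\<close> is vacuous here: \<open>d\<close> sees
      \<open>b\<close> and \<open>y\<close> sees \<open>a\<close>, so no vertex of the unguarded
      clique is safe.\<close>
    proof (rule cop_number_less[OF _ y'(2)])
      fix u v
      assume u: "col u = col b" "\<not> step G d u" "\<not> step G y u" and uv: "{u, v} \<in> edges G"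
      have "u = a \<or> u = b"
        using K u b simple_graph_edgeD[OF simple uv] by simp
      moreover have "step G y a" "step G d b"
        using y y' bd bd' by (simp_all add: step_def insert_commute)
      ultimately show "col v \<noteq> col d"
        using u by blast
    qed
  qed
qed

end

lemma ex_clique_cover:
  assumes "simple_graph G"
  shows "\<exists>col. clique_cover G (chromatic_number (compl_graph G)) col"
proof -
  let ?P = "\<lambda>k. \<exists>col. col ` verts G \<subseteq> {..<k} \<and> (\<forall>u\<in>verts G. \<forall>v\<in>verts G.
    {u, v} \<in> edges (compl_graph G) \<longrightarrow> col u \<noteq> (col v :: nat))"
  have "finite (verts G)"
    using assms by (simp add: simple_graph_def)
  then obtain h where h: "bij_betw h (verts G) {0..<card (verts G)}"
    using ex_bij_betw_finite_nat by blast
  \<comment> \<open>An injective numbering is a proper colouring, so the least number of colours is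
    attained.\<close>
  have "?P (card (verts G))"
    using h by (intro exI[of _ h]) (auto simp: bij_betw_def inj_on_def edge_compl_graph_iff)
  then have "?P (chromatic_number (compl_graph G))"
    unfolding chromatic_number_def verts_compl_graph by (rule LeastI)
  then obtain col where "col ` verts G \<subseteq> {..<chromatic_number (compl_graph G)}"
    "\<forall>u\<in>verts G. \<forall>v\<in>verts G. {u, v} \<in> edges (compl_graph G) \<longrightarrow> col u \<noteq> col v"
    by blast
  then have "clique_cover G (chromatic_number (compl_graph G)) col"
    by unfold_locales (use assms in \<open>auto simp: step_def edge_compl_graph_iff\<close>)
  then show ?thesis by blast
qed

section \<open>Counting\<close>

lemma finite_labelled_graphs: "finite (labelled_graphs n \<G>)"
proof (rule finite_subset)
  show "labelled_graphs n \<G> \<subseteq> {{..<n}} \<times> Pow (Pow {..<n})"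
    by (force simp: labelled_graphs_def simple_graph_def nsets_def)
qed simp

text \<open>Complementation is an involution on the graphs with vertex set \<open>{..<n}\<close>. It
  exchanges the two classes, so numerators and denominators agree for every \<open>n\<close>; the
  denominator is the case where \<open>Q\<close> is always true.\<close>

lemma almost_every_compl_graph:
  assumes "almost_every (free_of H) P" "simple_graph H" "graph_iso (compl_graph H) H'"
  shows "almost_every (free_of H') (\<lambda>G. P (compl_graph G))"
proof -
  have card_eq: "card {G \<in> labelled_graphs n (free_of H'). Q (compl_graph G)} =
      card {G \<in> labelled_graphs n (free_of H). Q G}" for n Q
  proof (rule bij_betw_same_card)
    have "free_of H' (compl_graph G) \<longleftrightarrow> free_of H G" if "simple_graph G" for G :: "nat graph"
      using free_of_compl_graph_iff[OF assms(2,3) simple_graph_compl[OF that]]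
      by (simp add: compl_graph_compl_graph that)
    then show "bij_betw compl_graph {G \<in> labelled_graphs n (free_of H'). Q (compl_graph G)}
        {G \<in> labelled_graphs n (free_of H). Q G}"
      by (intro bij_betw_byWitness[where f' = compl_graph])
        (auto simp: labelled_graphs_def compl_graph_compl_graph simple_graph_compl
          free_of_compl_graph_iff[OF assms(2,3)])
  qed
  show ?thesis
    using assms(1) card_eq[of _ P] card_eq[of _ "\<lambda>_. True"] by (simp add: almost_every_def)
qed

text \<open>There are \<open>(n + 1) ^ n\<close> choices for each of \<open>f\<close> and
  \<open>g\<close>. The decoding \<open>code\<close> is a parameter because the two exceptional
  classes are encoded differently.\<close>

lemma card_graphs_with_code_le:
  assumes "\<And>G. G \<in> A \<Longrightarrow> verts G = {..<n} \<and>
    (\<exists>f g. f \<in> {..<n} \<rightarrow>\<^sub>E {..n} \<and> g \<in> {..<n} \<rightarrow>\<^sub>E {..n} \<and> edges G = code f g)"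
  shows "card A \<le> (n + 1) ^ (2 * n)"
proof -
  let ?F = "{..<n} \<rightarrow>\<^sub>E {..n}"
  have fin: "finite ?F"
    by (intro finite_PiE) auto
  have "A \<subseteq> (\<lambda>(f, g). ({..<n}, code f g)) ` (?F \<times> ?F)"
  proof
    fix G assume "G \<in> A"
    then obtain f g where "f \<in> ?F" "g \<in> ?F" "G = ({..<n}, code f g)"
      using assms[of G] by (metis prod.collapse)
    then show "G \<in> (\<lambda>(f, g). ({..<n}, code f g)) ` (?F \<times> ?F)"
      by (intro image_eqI[of _ _ "(f, g)"]) auto
  qed
  then have "card A \<le> card (?F \<times> ?F)"
    using fin by (intro surj_card_le) auto
  also have "\<dots> = (n + 1) ^ (2 * n)"
    by (simp add: card_cartesian_product card_PiE power_add mult_2)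
  finally show ?thesis .
qed

section \<open>Lower bounds for the two classes and comparison of growth\<close>

text \<open>The edges inside \<open>{..<m}\<close> are prescribed by \<open>X\<close> and there are
  none inside \<open>{m..<n}\<close>; the \<open>m * (n - m)\<close> pairs between the two sides can
  be chosen freely, and different choices give different graphs.\<close>

lemma card_labelled_graphs_ge:
  assumes X: "X \<subseteq> [{..<m}]\<^bsup>2\<^esup>" and "m \<le> n"
    and ind: "\<And>E. (\<And>u v. u < m \<Longrightarrow> v < m \<Longrightarrow> {u, v} \<in> E \<longleftrightarrow> {u, v} \<in> X) \<Longrightarrow>
      (\<And>u v. m \<le> u \<Longrightarrow> m \<le> v \<Longrightarrow> {u, v} \<notin> E) \<Longrightarrow> simple_graph ({..<n}, E) \<Longrightarrow> \<G> ({..<n}, E)"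
  shows "2 ^ (m * (n - m)) \<le> card (labelled_graphs n \<G>)"
proof -
  define E where "E F = X \<union> (\<lambda>(a, b). {a, b}) ` F" for F :: "(nat \<times> nat) set"
  let ?AB = "{..<m} \<times> {m..<n}"
  have X': "u < m" "v < m" if "{u, v} \<in> X" for u v
    using X that doubleton_in_nsets_2_iff[of u v "{..<m}"] by auto
  have inner: "{u, v} \<in> E F \<longleftrightarrow> {u, v} \<in> X" if "F \<subseteq> ?AB" "u < m" "v < m" for F u v
    using that by (auto simp: E_def doubleton_eq_iff)
  have outer: "{u, v} \<notin> E F" if "F \<subseteq> ?AB" "m \<le> u" "m \<le> v" for F u v
    using that X'[of u v] by (auto simp: E_def doubleton_eq_iff)
  have cross: "{u, v} \<in> E F \<longleftrightarrow> (u, v) \<in> F" if "F \<subseteq> ?AB" "u < m" "m \<le> v" for F u v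
    using that X'[of u v] by (force simp: E_def doubleton_eq_iff)
  have simple: "simple_graph ({..<n}, E F)" if "F \<subseteq> ?AB" for F
  proof -
    have "[{..<m}]\<^bsup>2\<^esup> \<subseteq> [{..<n}]\<^bsup>2\<^esup>"
      using \<open>m \<le> n\<close> by (intro nsets_mono) auto
    moreover have "{a, b} \<in> [{..<n}]\<^bsup>2\<^esup>" if "(a, b) \<in> F" for a b
      using that \<open>F \<subseteq> ?AB\<close> by (auto simp: doubleton_in_nsets_2_iff)
    ultimately show ?thesis
      using X by (auto simp: simple_graph_def E_def)
  qed
  have "inj_on (\<lambda>F. ({..<n}, E F)) (Pow ?AB)"
  proof (rule inj_onI)
    fix F F' assume F: "F \<in> Pow ?AB" "F' \<in> Pow ?AB" and "({..<n}, E F) = ({..<n}, E F')"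
    then have "(u, v) \<in> F \<longleftrightarrow> (u, v) \<in> F'" if "u < m" "m \<le> v" for u v
      using cross[of F u v] cross[of F' u v] that by simp
    then show "F = F'"
      using F by auto
  qed
  moreover have "(\<lambda>F. ({..<n}, E F)) ` Pow ?AB \<subseteq> labelled_graphs n \<G>"
    using inner outer simple ind by (auto simp: labelled_graphs_def)
  ultimately have "card (Pow ?AB) \<le> card (labelled_graphs n \<G>)"
    using finite_labelled_graphs by (metis card_image card_mono)
  then show ?thesis
    by (simp add: card_Pow card_cartesian_product)
qed

text \<open>Bipartite graphs: every edge changes sides, so there is no closed walk of length
  3.\<close>

lemma card_C3_free_ge:
  "2 ^ (n div 2 * (n - n div 2)) \<le> card (labelled_graphs n (free_of (cycle_graph 3)))"
proof (rule card_labelled_graphs_ge[of "{}"])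
  fix E :: "nat set set"
  assume *: "\<And>u v. u < n div 2 \<Longrightarrow> v < n div 2 \<Longrightarrow> {u, v} \<in> E \<longleftrightarrow> {u, v} \<in> {}"
    "\<And>u v. n div 2 \<le> u \<Longrightarrow> n div 2 \<le> v \<Longrightarrow> {u, v} \<notin> E"
    and simple: "simple_graph ({..<n}, E)"
  have "(u < n div 2) \<noteq> (v < n div 2)" if "{u, v} \<in> E" for u v
    using *[of u v] that by (meson empty_iff not_le)
  then show "free_of (cycle_graph 3) ({..<n}, E)"
    unfolding free_of_cycle_graph_3_iff[OF simple] snd_conv by blast
qed auto

text \<open>Split graphs: the lower half is a clique and the upper half independent. In an induced
  four-cycle each diagonal would have an end in the upper half, and two such ends, one from each
  diagonal, would be adjacent.\<close>

lemma card_C4_free_ge: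
  "2 ^ (n div 2 * (n - n div 2)) \<le> card (labelled_graphs n (free_of (cycle_graph 4)))"
proof (rule card_labelled_graphs_ge[of "[{..<n div 2}]\<^bsup>2\<^esup>"])
  fix E :: "nat set set"
  assume *: "\<And>u v. u < n div 2 \<Longrightarrow> v < n div 2 \<Longrightarrow> {u, v} \<in> E \<longleftrightarrow> {u, v} \<in> [{..<n div 2}]\<^bsup>2\<^esup>"
    "\<And>u v. n div 2 \<le> u \<Longrightarrow> n div 2 \<le> v \<Longrightarrow> {u, v} \<notin> E"
    and simple: "simple_graph ({..<n}, E)"
  have clique: "{u, v} \<in> E" if "u < n div 2" "v < n div 2" "u \<noteq> v" for u v
    using *(1)[of u v] that by (simp add: doubleton_in_nsets_2_iff)
  have False if "a \<noteq> c" "b \<noteq> d" "{a, b} \<in> E" "{b, c} \<in> E" "{c, d} \<in> E" "{d, a} \<in> E"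
    "{a, c} \<notin> E" "{b, d} \<notin> E" for a b c d
  proof -
    have "n div 2 \<le> a \<or> n div 2 \<le> c" "n div 2 \<le> b \<or> n div 2 \<le> d"
      using clique[of a c] clique[of b d] that by linarith+
    then show False
      using *(2)[of a b] *(2)[of b c] *(2)[of c d] *(2)[of d a] that by blast
  qed
  then show "free_of (cycle_graph 4) ({..<n}, E)"
    unfolding free_of_cycle_graph_4_iff[OF simple] snd_conv by blast
qed auto

text \<open>The numerator is 2 to the power \<open>2 * n\<close> times the binary logarithm of
  \<open>n + 1\<close>, while the exponent in the denominator is quadratic. Bounding that exponent
  below by \<open>(n ^ 2 - 1) / 4\<close> removes the integer division.\<close>

lemma code_growth_negligible:
  "(\<lambda>n. real ((n + 1) ^ (2 * n)) / 2 ^ (n div 2 * (n - n div 2))) \<longlonglongrightarrow> 0"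
proof (rule tendsto_sandwich[OF _ _ tendsto_const])
  show "(\<lambda>n. (real n + 1) powr (2 * real n) / 2 powr ((real n ^ 2 - 1) / 4)) \<longlonglongrightarrow> 0"
    by real_asymp
  have "real ((n + 1) ^ (2 * n)) / 2 ^ (n div 2 * (n - n div 2)) \<le>
      (real n + 1) powr (2 * real n) / 2 powr ((real n ^ 2 - 1) / 4)" for n
  proof -
    \<comment> \<open>The summand 1 is for odd \<open>n\<close>, where equality holds.\<close>
    have "n ^ 2 \<le> 4 * (n div 2 * (n - n div 2)) + 1"
      by (cases "even n") (auto elim!: evenE oddE simp: power2_eq_square algebra_simps)
    then have "real (n ^ 2) \<le> real (4 * (n div 2 * (n - n div 2)) + 1)"
      by (rule of_nat_mono)
    then have "(real n ^ 2 - 1) / 4 \<le> real (n div 2 * (n - n div 2))"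
      by simp
    then have "2 powr ((real n ^ 2 - 1) / 4) \<le> 2 powr real (n div 2 * (n - n div 2))"
      by (intro powr_mono) auto
    also have "\<dots> = 2 ^ (n div 2 * (n - n div 2))"
      by (rule powr_realpow) simp
    finally have "2 powr ((real n ^ 2 - 1) / 4) \<le> 2 ^ (n div 2 * (n - n div 2))" .
    moreover have "real ((n + 1) ^ (2 * n)) = (real n + 1) powr (2 * real n)"
      using powr_realpow[of "real n + 1" "2 * n"] by (simp add: add.commute)
    ultimately show ?thesis
      by (simp only:) (intro divide_left_mono, auto)
  qed
  then show "\<forall>\<^sub>F n in sequentially. real ((n + 1) ^ (2 * n)) / 2 ^ (n div 2 * (n - n div 2)) \<le>
      (real n + 1) powr (2 * real n) / 2 powr ((real n ^ 2 - 1) / 4)"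
    by simp
qed simp

text \<open>Up to the set of \<open>B\<close>-graphs, \<open>P\<close> is contained in
  \<open>R\<close>. Hence the proportion of \<open>R\<close> is at least that of \<open>P\<close>
  minus that of \<open>B\<close>, and the last tends to 0.\<close>

lemma almost_every_up_to_few:
  assumes P: "almost_every \<G> P"
    and imp: "\<And>n G. G \<in> labelled_graphs n \<G> \<Longrightarrow> P G \<Longrightarrow> \<not> B G \<Longrightarrow> R G"
    and few: "\<And>n. card {G \<in> labelled_graphs n \<G>. B G} \<le> (n + 1) ^ (2 * n)"
    and many: "\<And>n. 2 ^ (n div 2 * (n - n div 2)) \<le> card (labelled_graphs n \<G>)"
  shows "almost_every \<G> R"
  unfolding almost_every_def
proof (rule tendsto_sandwich[OF _ _ _ tendsto_const])
  let ?c = "\<lambda>n. real (card (labelled_graphs n \<G>))"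
  let ?p = "\<lambda>n. real (card {G \<in> labelled_graphs n \<G>. P G})"
  let ?r = "\<lambda>n. real (card {G \<in> labelled_graphs n \<G>. R G})"
  let ?e = "\<lambda>n. real ((n + 1) ^ (2 * n)) / 2 ^ (n div 2 * (n - n div 2))"
  show "(\<lambda>n. ?p n / ?c n - ?e n) \<longlonglongrightarrow> 1"
    using tendsto_diff[OF P[unfolded almost_every_def] code_growth_negligible] by simp
  have many': "2 ^ (n div 2 * (n - n div 2)) \<le> ?c n" for n
    using of_nat_mono[OF many[of n], where 'a = real] by simp
  then have pos: "0 < ?c n" for n
    using less_le_trans[of 0 "2 ^ (n div 2 * (n - n div 2))" "?c n"] by simp
  have "?p n / ?c n - ?e n \<le> ?r n / ?c n" for n
  proof -
    have "card {G \<in> labelled_graphs n \<G>. P G} \<le>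
        card ({G \<in> labelled_graphs n \<G>. R G} \<union> {G \<in> labelled_graphs n \<G>. B G})"
      using imp by (intro card_mono) (auto simp: finite_labelled_graphs)
    also have "\<dots> \<le> card {G \<in> labelled_graphs n \<G>. R G} + card {G \<in> labelled_graphs n \<G>. B G}"
      by (rule card_Un_le)
    finally have "card {G \<in> labelled_graphs n \<G>. P G} \<le>
        card {G \<in> labelled_graphs n \<G>. R G} + (n + 1) ^ (2 * n)"
      using few[of n] by linarith
    then have "?p n \<le> ?r n + real ((n + 1) ^ (2 * n))"
      using of_nat_mono[where 'a = real] unfolding of_nat_add[symmetric] by blast
    then have "?p n / ?c n \<le> (?r n + real ((n + 1) ^ (2 * n))) / ?c n"
      using pos[of n] by (intro divide_right_mono) auto
    also have "\<dots> = ?r n / ?c n + real ((n + 1) ^ (2 * n)) / ?c n"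
      by (rule add_divide_distrib)
    also have "real ((n + 1) ^ (2 * n)) / ?c n \<le> ?e n"
      using many'[of n] pos[of n] by (intro divide_left_mono) auto
    finally show ?thesis by simp
  qed
  then show "\<forall>\<^sub>F n in sequentially. ?p n / ?c n - ?e n \<le> ?r n / ?c n"
    by simp
  have "?r n \<le> ?c n" for n
    by (auto intro!: card_mono simp: finite_labelled_graphs)
  then show "\<forall>\<^sub>F n in sequentially. ?r n / ?c n \<le> 1"
    using pos by (simp add: divide_le_eq_1_pos)
qed

section \<open>The exceptional classes are small\<close>

definition max_degree_le_2 :: "'a graph \<Rightarrow> bool" where
  "max_degree_le_2 G \<longleftrightarrow> (\<forall>a b1 b2 b3. {a, b1} \<in> edges G \<and> {a, b2} \<in> edges G \<and>
     {a, b3} \<in> edges G \<longrightarrow> b1 = b2 \<or> b2 = b3 \<or> b1 = b3)"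

text \<open>Each vertex \<open>u\<close> records its at most two neighbours as \<open>f u\<close>
  and \<open>g u\<close>, a single neighbour being recorded twice.\<close>

lemma card_max_degree_le_2_le:
  "card {G \<in> labelled_graphs n \<G>. max_degree_le_2 G} \<le> (n + 1) ^ (2 * n)"
proof (rule card_graphs_with_code_le)
  fix G assume "G \<in> {G \<in> labelled_graphs n \<G>. max_degree_le_2 G}"
  then have G: "simple_graph G" "verts G = {..<n}" and deg: "max_degree_le_2 G"
    by (auto simp: labelled_graphs_def)
  \<comment> \<open>The value \<open>n\<close> stands for a missing neighbour.\<close>
  let ?code = "\<lambda>f g :: nat \<Rightarrow> nat. {{u, v} |u v. u < n \<and> v < n \<and> (v = f u \<or> v = g u)}"
  have "\<exists>x y. x \<le> n \<and> y \<le> n \<and> (\<forall>v. {u, v} \<in> edges G \<longleftrightarrow> v < n \<and> (v = x \<or> v = y))" for u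
  proof (cases "\<exists>x. {u, x} \<in> edges G")
    case False
    then show ?thesis
      by (intro exI[of _ n]) auto
  next
    case True
    then obtain x where x: "{u, x} \<in> edges G" ..
    have less: "v < n" if "{u, v} \<in> edges G" for v
      using simple_graph_edgeD(2)[OF G(1) that] G(2) by simp
    show ?thesis
    proof (cases "\<exists>y. {u, y} \<in> edges G \<and> y \<noteq> x")
      case True
      then obtain y where y: "{u, y} \<in> edges G" "y \<noteq> x"
        by blast
      have "{u, v} \<in> edges G \<longleftrightarrow> v < n \<and> (v = x \<or> v = y)" for v
        using deg[unfolded max_degree_le_2_def, rule_format, of u x y v] x y less[of v] by auto
      with less[OF x] less[OF y(1)] show ?thesis
        by (intro exI[of _ x] exI[of _ y]) simp
    next
      case False
      have "{u, v} \<in> edges G \<longleftrightarrow> v < n \<and> (v = x \<or> v = x)" for v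
        using False x less[of v] by blast
      with less[OF x] show ?thesis
        by (intro exI[of _ x]) simp
    qed
  qed
  then obtain f g where fg: "\<And>u. f u \<le> n" "\<And>u. g u \<le> n"
    "\<And>u v. {u, v} \<in> edges G \<longleftrightarrow> v < n \<and> (v = f u \<or> v = g u)"
    by metis
  have "edges G = {{u, v} |u v. u < n \<and> v < n \<and> {u, v} \<in> edges G}"
  proof (intro equalityI subsetI)
    fix e assume "e \<in> edges G"
    then obtain u v where "e = {u, v}" "u < n" "v < n"
      using simple_graph_edgeE[OF G(1)] G(2) by (metis lessThan_iff)
    with \<open>e \<in> edges G\<close> show "e \<in> {{u, v} |u v. u < n \<and> v < n \<and> {u, v} \<in> edges G}"
      by blast
  qed auto
  also have "\<dots> = ?code (restrict f {..<n}) (restrict g {..<n})"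
  proof -
    have "u < n \<and> v < n \<and> {u, v} \<in> edges G \<longleftrightarrow>
        u < n \<and> v < n \<and> (v = restrict f {..<n} u \<or> v = restrict g {..<n} u)" for u v
      using fg(3)[of u v] by auto
    then show ?thesis
      by (simp only:)
  qed
  finally show "verts G = {..<n} \<and> (\<exists>f g. f \<in> {..<n} \<rightarrow>\<^sub>E {..n} \<and> g \<in> {..<n} \<rightarrow>\<^sub>E {..n} \<and>
      edges G = ?code f g)"
    using G(2) fg(1,2)
    by (intro conjI exI[of _ "restrict f {..<n}"] exI[of _ "restrict g {..<n}"]) auto
qed

text \<open>Here \<open>f\<close> labels the cliques. Its bound makes a labelling of an
  \<open>n\<close>-vertex graph a function into \<open>{..n}\<close>, as the counting bound
  requires.\<close>

definition disjoint_cliques :: "'a graph \<Rightarrow> bool" where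
  "disjoint_cliques G \<longleftrightarrow> (\<exists>f :: 'a \<Rightarrow> nat. (\<forall>v\<in>verts G. f v \<le> card (verts G)) \<and>
     edges G = {{u, v} |u v. u \<in> verts G \<and> v \<in> verts G \<and> u \<noteq> v \<and> f u = f v})"

lemma card_disjoint_cliques_le:
  "card {G \<in> labelled_graphs n \<G>. disjoint_cliques G} \<le> (n + 1) ^ (2 * n)"
proof (rule card_graphs_with_code_le)
  fix G assume "G \<in> {G \<in> labelled_graphs n \<G>. disjoint_cliques G}"
  then have G: "verts G = {..<n}" and "disjoint_cliques G"
    by (auto simp: labelled_graphs_def)
  then obtain f where f: "\<forall>v\<in>{..<n}. f v \<le> n"
    "edges G = {{u, v} |u v. u < n \<and> v < n \<and> u \<noteq> v \<and> f u = (f v :: nat)}"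
    unfolding disjoint_cliques_def G card_lessThan lessThan_iff by (elim exE conjE)
  let ?code = "\<lambda>f g :: nat \<Rightarrow> nat. {{u, v} |u v. u < n \<and> v < n \<and> u \<noteq> v \<and> f u = f v}"
  \<comment> \<open>The labelling alone determines the graph; it is supplied twice to match the
    format of codes by pairs.\<close>
  have "edges G = ?code (restrict f {..<n}) (restrict f {..<n})"
  proof -
    have "u < n \<and> v < n \<and> u \<noteq> v \<and> f u = f v \<longleftrightarrow>
        u < n \<and> v < n \<and> u \<noteq> v \<and> restrict f {..<n} u = restrict f {..<n} v" for u v
      by auto
    then show ?thesis
      unfolding f(2) by (simp only:)
  qed
  then show "verts G = {..<n} \<and> (\<exists>f g. f \<in> {..<n} \<rightarrow>\<^sub>E {..n} \<and> g \<in> {..<n} \<rightarrow>\<^sub>E {..n} \<and>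
      edges G = ?code f g)"
    using G f(1)
    by (intro conjI exI[of _ "restrict f {..<n}"]) auto
qed

section \<open>From perfect clique covers to the inequality\<close>

lemma cop_number_less_independence_number_C3:
  assumes "simple_graph G" "free_of (cycle_graph 3) G" "\<not> max_degree_le_2 G"
    and "chromatic_number (compl_graph G) = clique_number (compl_graph G)"
  shows "cop_number G < independence_number G"
proof -
  obtain col where "clique_cover G (independence_number G) col"
    using ex_clique_cover[OF assms(1)] assms(4) by (auto simp: clique_number_compl_graph)
  then interpret clique_cover G "independence_number G" col .
  obtain a b1 b2 b3 where "{a, b1} \<in> edges G" "{a, b2} \<in> edges G" "{a, b3} \<in> edges G"
    "b1 \<noteq> b2" "b2 \<noteq> b3" "b1 \<noteq> b3"
    using assms(3) unfolding max_degree_le_2_def by blast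
  then show ?thesis
    by (rule cop_number_less_if_C3_free[OF assms(2)])
qed

text \<open>If every edge stayed inside a colour class of the cover by \<alpha>(G) cliques,
  \<open>col\<close> itself would exhibit \<open>G\<close> as a disjoint union of cliques. So some
  edge joins two of the cliques.\<close>

lemma cop_number_less_independence_number_C4:
  assumes "simple_graph G" "free_of (cycle_graph 4) G" "\<not> disjoint_cliques G"
    and "chromatic_number (compl_graph G) = clique_number (compl_graph G)"
  shows "cop_number G < independence_number G"
proof -
  obtain col where "clique_cover G (independence_number G) col"
    using ex_clique_cover[OF assms(1)] assms(4) by (auto simp: clique_number_compl_graph)
  then interpret clique_cover G "independence_number G" col .
  have "\<exists>a b. {a, b} \<in> edges G \<and> col a \<noteq> col b"
  proof (rule ccontr)
    assume inside: "\<not> ?thesis"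
    have "edges G = {{u, v} |u v. u \<in> verts G \<and> v \<in> verts G \<and> u \<noteq> v \<and> col u = col v}"
      (is "_ = ?E")
    proof (intro equalityI subsetI)
      fix e assume "e \<in> edges G"
      then obtain u v where "e = {u, v}" "u \<in> verts G" "v \<in> verts G" "u \<noteq> v"
        by (rule simple_graph_edgeE[OF assms(1)])
      moreover have "col u = col v"
        using inside \<open>e \<in> edges G\<close> unfolding \<open>e = {u, v}\<close> by blast
      ultimately show "e \<in> ?E"
        by blast
    next
      fix e assume "e \<in> ?E"
      then obtain u v where "e = {u, v}" "u \<in> verts G" "v \<in> verts G" "u \<noteq> v" "col u = col v"
        by blast
      then show "e \<in> edges G"
        by (simp add: adjacent_if_col_eq)
    qed
    \<comment> \<open>The colours are below \<alpha>(G), which is at most the number of vertices, so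
      they are admissible labels.\<close>
    moreover have "col v \<le> card (verts G)" if "v \<in> verts G" for v
      using col_less[OF that] independence_number_le[of G] assms(1)
      by (simp add: simple_graph_def)
    ultimately have "disjoint_cliques G"
      unfolding disjoint_cliques_def by (intro exI[of _ col]) simp
    with assms(3) show False ..
  qed
  then obtain a b where "{a, b} \<in> edges G" "col a \<noteq> col b"
    by blast
  then show ?thesis
    by (rule cop_number_less_if_C4_free[OF assms(2)])
qed

theorem theorem1p4:
  fixes l :: nat
  assumes "almost_every (free_of three_K1) (\<lambda>G. chromatic_number G = clique_number G)"
    and "almost_every (free_of two_K2) (\<lambda>G. chromatic_number G = clique_number G)"
    and "l \<in> {3, 4}"
  shows "almost_every (free_of (cycle_graph l)) (\<lambda>G. cop_number G < independence_number G)"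
proof -
  consider "l = 3" | "l = 4"
    using assms(3) by auto
  then show ?thesis
  proof cases
    case 1
    have "almost_every (free_of (cycle_graph 3)) (\<lambda>G. cop_number G < independence_number G)"
    \<comment> \<open>The exceptional property \<open>B\<close> is \<open>max_degree_le_2\<close>
      here, and \<open>disjoint_cliques\<close> in the case of length 4.\<close>
    proof (rule almost_every_up_to_few)
      show "almost_every (free_of (cycle_graph 3))
          (\<lambda>G. chromatic_number (compl_graph G) = clique_number (compl_graph G))"
        using almost_every_compl_graph[OF assms(1) simple_graph_three_K1 graph_iso_compl_three_K1] .
    next
      fix n and G :: "nat graph"
      assume "G \<in> labelled_graphs n (free_of (cycle_graph 3))" "\<not> max_degree_le_2 G"
        "chromatic_number (compl_graph G) = clique_number (compl_graph G)"
      then show "cop_number G < independence_number G"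
        by (auto simp: labelled_graphs_def intro: cop_number_less_independence_number_C3)
    qed (rule card_max_degree_le_2_le card_C3_free_ge)+
    with 1 show ?thesis by simp
  next
    case 2
    have "almost_every (free_of (cycle_graph 4)) (\<lambda>G. cop_number G < independence_number G)"
    proof (rule almost_every_up_to_few)
      show "almost_every (free_of (cycle_graph 4))
          (\<lambda>G. chromatic_number (compl_graph G) = clique_number (compl_graph G))"
        using almost_every_compl_graph[OF assms(2) simple_graph_two_K2 graph_iso_compl_two_K2] .
    next
      fix n and G :: "nat graph"
      assume "G \<in> labelled_graphs n (free_of (cycle_graph 4))" "\<not> disjoint_cliques G"
        "chromatic_number (compl_graph G) = clique_number (compl_graph G)"
      then show "cop_number G < independence_number G"
        by (auto simp: labelled_graphs_def intro: cop_number_less_independence_number_C4)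
    qed (rule card_disjoint_cliques_le card_C4_free_ge)+
    with 2 show ?thesis by simp
  qed
qed

end
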